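(* Let $n\ge1$ and let $\psi$ be defined below. Then $\psi$ is a bijection from $S_n(132)$ to itself, and for every $\pi\in S_n(132)$, $$\bigl(B(\psi(\pi)),\,\mathsf{des}(\psi(\pi))\bigr)=\bigl(A(\pi),\,\mathsf{des}(\pi)\bigr).$$
   Context: $S_n$ is the set of permutations of $\{1,\dots,n\}$ in one-line notation $\pi=\pi_1\cdots\pi_n$; $S_n(132)$ those avoiding the classical pattern $132$. $\mathsf{des}(\pi)=\mathrm{card}\{i<n:\pi_i>\pi_{i+1}\}$; $A(\pi)=\mathrm{card}\{(i,j):1\le i<j\le n-1,\ \pi_{j+1}<\pi_i<\pi_j\}$ (vincular pattern $2\text{-}\underline{31}$); $B(\pi)=\mathrm{card}\{(i,j):1\le i<j\le n-1,\ \pi_j<\pi_i<\pi_{j+1}\}$ (vincular pattern $2\text{-}\underline{13}$). For permutations $\alpha$ (length $a$), $\beta$ (length $b$): $\alpha\oplus\beta$ has entries $\alpha_i$ ($i\le a$) and $\beta_{i-a}+a$ ($i>a$); $\alpha\ominus\beta$ has entries $\alpha_i+b$ ($i\le a$) and $\beta_{i-a}$ ($i>a$); $1$ is the length-one permutation. A nonempty $132$-avoiding permutation can be written uniquely as $(\alpha\oplus1)\ominus\beta$ and also uniquely as $\alpha\ominus(\beta\oplus1)$, with $\alpha,\beta$ possibly empty $132$-avoiding permutations. The map $\psi$ is defined recursively on nonempty $132$-avoiding permutations (its values being $132$-avoiding, the decompositions used exist): $\psi(1)=1$; for $\pi\in S_n(132)$, $n\ge2$: (i) if $\pi=1\ominus\alpha$,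 then $\psi(\pi)=1\ominus\psi(\alpha)$; (ii) if $\pi=(\alpha\oplus1)\ominus\beta$ with $\alpha,\beta$ nonempty, write $\psi(\beta)=\gamma\ominus(\delta\oplus1)$ and set $\psi(\pi)=((\psi(\alpha)\ominus(\delta\oplus1))\oplus1)\ominus\gamma$; (iii) if $\pi=\alpha\oplus1$ with $\alpha$ nonempty, write $\psi(\alpha)=(\gamma\oplus1)\ominus\delta$ and set $\psi(\pi)=((\gamma\oplus1)\oplus1)\ominus\delta$. *)

theory Defs
  imports "HOL-Combinatorics.Multiset_Permutations"
begin

text \<open>
  Permutations of \<open>{1..n}\<close> are lists in one-line notation. List positions start at \<open>0\<close>, so
  \<open>\<pi> ! i\<close> is the entry usually written \<open>\<pi>\<^sub>i\<^sub>+\<^sub>1\<close>, and the position ranges below are shifted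
  accordingly.
\<close>

definition avoids132 :: "nat list \<Rightarrow> bool" where
  "avoids132 \<pi> \<longleftrightarrow>
     \<not> (\<exists>i j k. i < j \<and> j < k \<and> k < length \<pi> \<and> \<pi> ! i < \<pi> ! k \<and> \<pi> ! k < \<pi> ! j)"

definition Av132 :: "nat \<Rightarrow> nat list set" where
  "Av132 n = {\<pi> \<in> permutations_of_set {1..n}. avoids132 \<pi>}"

definition des :: "nat list \<Rightarrow> nat" where
  "des \<pi> = card {i. i + 1 < length \<pi> \<and> \<pi> ! i > \<pi> ! (i + 1)}"

definition stat_A :: "nat list \<Rightarrow> nat" where
  "stat_A \<pi> =
     card {(i, j). i < j \<and> j + 1 < length \<pi> \<and> \<pi> ! (j + 1) < \<pi> ! i \<and> \<pi> ! i < \<pi> ! j}"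

definition stat_B :: "nat list \<Rightarrow> nat" where
  "stat_B \<pi> =
     card {(i, j). i < j \<and> j + 1 < length \<pi> \<and> \<pi> ! j < \<pi> ! i \<and> \<pi> ! i < \<pi> ! (j + 1)}"

definition direct_sum :: "nat list \<Rightarrow> nat list \<Rightarrow> nat list"  (infixl "\<oplus>" 65) where
  "\<alpha> \<oplus> \<beta> = \<alpha> @ map (\<lambda>x. x + length \<alpha>) \<beta>"

definition skew_sum :: "nat list \<Rightarrow> nat list \<Rightarrow> nat list"  (infixl "\<ominus>" 65) where
  "\<alpha> \<ominus> \<beta> = map (\<lambda>x. x + length \<beta>) \<alpha> @ \<beta>"

definition is_split_max :: "nat list \<Rightarrow> nat list \<times> nat list \<Rightarrow> bool" where
  "is_split_max \<pi> = (\<lambda>(\<alpha>, \<beta>). \<alpha> \<in> Av132 (length \<alpha>) \<and> \<beta> \<in> Av132 (length \<beta>) \<and>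
     \<pi> = (\<alpha> \<oplus> [1]) \<ominus> \<beta>)"

definition is_split_last :: "nat list \<Rightarrow> nat list \<times> nat list \<Rightarrow> bool" where
  "is_split_last \<pi> = (\<lambda>(\<alpha>, \<beta>). \<alpha> \<in> Av132 (length \<alpha>) \<and> \<beta> \<in> Av132 (length \<beta>) \<and>
     \<pi> = \<alpha> \<ominus> (\<beta> \<oplus> [1]))"

text \<open>Both descriptions are meaningful on nonempty \<open>132\<close>-avoiding permutations; see
  \<open>ex1_split_max\<close> and \<open>ex1_split_last\<close>.\<close>

definition split_max :: "nat list \<Rightarrow> nat list \<times> nat list" where
  "split_max \<pi> = (THE p. is_split_max \<pi> p)"

definition split_last :: "nat list \<Rightarrow> nat list \<times> nat list" where
  "split_last \<pi> = (THE p. is_split_last \<pi> p)"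

lemma Av132_length: "\<pi> \<in> Av132 n \<Longrightarrow> length \<pi> = n"
  unfolding Av132_def permutations_of_set_def
  using distinct_card by fastforce

lemma Av132_iff:
  "\<pi> \<in> Av132 n \<longleftrightarrow> set \<pi> = {1..n} \<and> distinct \<pi> \<and> avoids132 \<pi>"
  by (auto simp: Av132_def permutations_of_set_def)

lemma avoids132_append1:
  assumes "avoids132 (xs @ ys)" shows "avoids132 xs"
  unfolding avoids132_def
proof (intro notI, elim exE conjE)
  fix i j k assume "i < j" "j < k" "k < length xs" "xs ! i < xs ! k" "xs ! k < xs ! j"
  then have "i < j \<and> j < k \<and> k < length (xs @ ys) \<and>
      (xs @ ys) ! i < (xs @ ys) ! k \<and> (xs @ ys) ! k < (xs @ ys) ! j"
    by (simp add: nth_append)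
  with assms show False unfolding avoids132_def by blast
qed

lemma avoids132_append2:
  assumes "avoids132 (xs @ ys)" shows "avoids132 ys"
  unfolding avoids132_def
proof (intro notI, elim exE conjE)
  fix i j k assume "i < j" "j < k" "k < length ys" "ys ! i < ys ! k" "ys ! k < ys ! j"
  then have "length xs + i < length xs + j \<and> length xs + j < length xs + k \<and>
      length xs + k < length (xs @ ys) \<and> (xs @ ys) ! (length xs + i) < (xs @ ys) ! (length xs + k) \<and>
      (xs @ ys) ! (length xs + k) < (xs @ ys) ! (length xs + j)"
    by simp
  with assms show False unfolding avoids132_def by blast
qed

lemma avoids132_shift:
  assumes "avoids132 (map (\<lambda>x. x + b) xs)" shows "avoids132 xs"
  unfolding avoids132_def
proof (intro notI, elim exE conjE)
  fix i j k assume "i < j" "j < k" "k < length xs" "xs ! i < xs ! k" "xs ! k < xs ! j"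
  then have "i < j \<and> j < k \<and> k < length (map (\<lambda>x. x + b) xs) \<and>
      map (\<lambda>x. x + b) xs ! i < map (\<lambda>x. x + b) xs ! k \<and>
      map (\<lambda>x. x + b) xs ! k < map (\<lambda>x. x + b) xs ! j"
    by simp
  with assms show False unfolding avoids132_def by blast
qed

lemma skew_decomposition:
  assumes perm: "xs @ ys \<in> Av132 n" and gt: "\<And>x y. x \<in> set xs \<Longrightarrow> y \<in> set ys \<Longrightarrow> y < x"
  obtains \<alpha> where "\<alpha> \<in> Av132 (length \<alpha>)" "ys \<in> Av132 (length ys)" "xs @ ys = \<alpha> \<ominus> ys"
proof -
  have S: "set xs \<union> set ys = {1..n}" and D: "distinct xs" "distinct ys" "set xs \<inter> set ys = {}"
    and V: "avoids132 (xs @ ys)" using perm by (auto simp: Av132_iff)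
  define b where "b = length ys"
  have cy: "card (set ys) = b" using D distinct_card b_def by metis
  have down: "{1..y} \<subseteq> set ys" if "y \<in> set ys" for y
  proof
    fix z assume z: "z \<in> {1..y}"
    have "y \<in> {1..n}" using S that by blast
    with z have "z \<in> set xs \<union> set ys" using S by auto
    moreover have "z \<notin> set xs" using gt[OF _ that] z by force
    ultimately show "z \<in> set ys" by blast
  qed
  have sub: "set ys \<subseteq> {1..b}"
  proof
    fix y assume y: "y \<in> set ys"
    have "card {1..y} \<le> b" using card_mono[OF _ down[OF y]] cy by simp
    moreover have "y \<in> {1..n}" using S y by blast
    ultimately show "y \<in> {1..b}" by simp
  qed
  have sy: "set ys = {1..b}" by (rule card_subset_eq[OF _ sub]) (simp_all add: cy)
  have bn: "b \<le> n"
  proof -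
    have "card (set ys) \<le> card {1..n}" by (rule card_mono) (use S in auto)
    then show ?thesis using cy by simp
  qed
  have sx: "set xs = {b+1..n}"
  proof -
    have "set xs = {1..n} - {1..b}" using S D sy by blast
    also have "\<dots> = {b+1..n}" by auto
    finally show ?thesis .
  qed
  define \<alpha> where "\<alpha> = map (\<lambda>x. x - b) xs"
  have xs: "xs = map (\<lambda>x. x + b) \<alpha>"
  proof -
    have "map (\<lambda>x. x + b) \<alpha> = map (\<lambda>x. x) xs"
      unfolding \<alpha>_def map_map by (rule map_cong) (use sx in auto)
    then show ?thesis by simp
  qed
  have la: "length \<alpha> = n - b"
    using distinct_card[OF D(1)] sx by (simp add: \<alpha>_def)
  have "set \<alpha> = {1..length \<alpha>}"
  proof -
    have "set \<alpha> = (\<lambda>x. x - b) ` {b+1..n}" by (simp add: \<alpha>_def sx)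
    also have "\<dots> = {1..n-b}"
    proof (intro equalityI subsetI)
      fix z assume "z \<in> {1..n-b}"
      then have "z + b \<in> {b+1..n}" "z = (z + b) - b" by auto
      then show "z \<in> (\<lambda>x. x - b) ` {b+1..n}" by blast
    qed auto
    finally show ?thesis by (simp add: la)
  qed
  moreover have "distinct \<alpha>" using D(1) xs by (metis distinct_map)
  moreover have "avoids132 \<alpha>" using avoids132_append1[OF V] xs avoids132_shift by metis
  ultimately have "\<alpha> \<in> Av132 (length \<alpha>)" by (simp add: Av132_iff)
  moreover have "ys \<in> Av132 (length ys)"
    using sy D(2) avoids132_append2[OF V] by (simp add: Av132_iff b_def)
  moreover have "xs @ ys = \<alpha> \<ominus> ys" using xs by (simp add: skew_sum_def b_def)
  ultimately show ?thesis using that by blast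
qed

lemma Av132_snoc_max:
  assumes "xs @ [m] \<in> Av132 n" and "\<And>x. x \<in> set xs \<Longrightarrow> x < m"
  shows "xs \<in> Av132 (length xs)" "xs @ [m] = xs \<oplus> [1]"
proof -
  have S: "insert m (set xs) = {1..n}" and D: "distinct xs" "m \<notin> set xs"
    and V: "avoids132 (xs @ [m])" using assms(1) by (auto simp: Av132_iff)
  have n: "n = length xs + 1" using Av132_length[OF assms(1)] by simp
  have "m = n"
  proof -
    have "n \<in> insert m (set xs)" "m \<in> {1..n}" using S n by auto
    then show ?thesis using assms(2)[of n] by fastforce
  qed
  then have "set xs = {1..n} - {n}" using S D by blast
  also have "\<dots> = {1..length xs}" using n by auto
  finally show "xs \<in> Av132 (length xs)"
    using D avoids132_append1[OF V] by (simp add: Av132_iff)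
  show "xs @ [m] = xs \<oplus> [1]" using \<open>m = n\<close> n by (simp add: direct_sum_def)
qed

lemma split_max_unique:
  assumes "is_split_max \<pi> (\<alpha>, \<beta>)" "is_split_max \<pi> (\<alpha>', \<beta>')"
  shows "\<alpha> = \<alpha>' \<and> \<beta> = \<beta>'"
proof -
  have shape: "\<pi> = map (\<lambda>x. x + length b) a @ (length a + 1 + length b) # b \<and>
      length \<pi> \<notin> set (map (\<lambda>x. x + length b) a) \<union> set b \<and>
      length a + 1 + length b = length \<pi>"
    if "is_split_max \<pi> (a, b)" for a b
    using that by (auto simp: is_split_max_def skew_sum_def direct_sum_def Av132_iff)
  note s1 = shape[OF assms(1)] and s2 = shape[OF assms(2)]
  have "map (\<lambda>x. x + length \<beta>) \<alpha> @ length \<pi> # \<beta> = map (\<lambda>x. x + length \<beta>') \<alpha>' @ length \<pi> # \<beta>'"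
    using s1 s2 by metis
  then have eq: "map (\<lambda>x. x + length \<beta>) \<alpha> = map (\<lambda>x. x + length \<beta>') \<alpha>' \<and> \<beta> = \<beta>'"
    using append_Cons_eq_iff[of "length \<pi>" "map (\<lambda>x. x + length \<beta>) \<alpha>" \<beta>] s1 s2 by blast
  then have "map (\<lambda>x. x + length \<beta>) \<alpha> = map (\<lambda>x. x + length \<beta>) \<alpha>'" by metis
  then have "\<alpha> = \<alpha>'" using inj_map_eq_map[of "\<lambda>x. x + length \<beta>"] by (simp add: inj_def)
  with eq show ?thesis by blast
qed

lemma split_last_unique:
  assumes "is_split_last \<pi> (\<alpha>, \<beta>)" "is_split_last \<pi> (\<alpha>', \<beta>')"
  shows "\<alpha> = \<alpha>' \<and> \<beta> = \<beta>'"
proof -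
  have shape: "\<pi> = map (\<lambda>x. x + last \<pi>) a @ b @ [last \<pi>] \<and> length b + 1 = last \<pi>"
    if "is_split_last \<pi> (a, b)" for a b
    using that by (auto simp: is_split_last_def skew_sum_def direct_sum_def)
  note s1 = shape[OF assms(1)] and s2 = shape[OF assms(2)]
  have "map (\<lambda>x. x + last \<pi>) \<alpha> @ \<beta> @ [last \<pi>] = map (\<lambda>x. x + last \<pi>) \<alpha>' @ \<beta>' @ [last \<pi>]"
    using s1 s2 by metis
  moreover have "length \<beta> = length \<beta>'" using s1 s2 by linarith
  ultimately have eq: "map (\<lambda>x. x + last \<pi>) \<alpha> = map (\<lambda>x. x + last \<pi>) \<alpha>' \<and> \<beta> = \<beta>'"
    by (simp add: append_eq_append_conv)
  then have "\<alpha> = \<alpha>'" using inj_map_eq_map[of "\<lambda>x. x + last \<pi>"] by (simp add: inj_def)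
  with eq show ?thesis by blast
qed

lemma ex1_split_max:
  assumes "\<pi> \<in> Av132 n" "n \<ge> 1"
  shows "\<exists>!p. is_split_max \<pi> p"
proof -
  have S: "set \<pi> = {1..n}" and D: "distinct \<pi>" and V: "avoids132 \<pi>"
    using assms by (auto simp: Av132_iff)
  have "n \<in> set \<pi>" using S assms by simp
  then obtain xs ys where pi: "\<pi> = xs @ n # ys" by (auto dest: split_list)
  have lt: "z < n" if "z \<in> set xs \<union> set ys" for z
  proof -
    have "z \<in> {1..n}" "z \<noteq> n" using that S D pi by auto
    then show ?thesis by simp
  qed
  have gt: "y < x" if xy: "x \<in> set xs" "y \<in> set ys" for x y
  proof (rule ccontr)
    assume "\<not> y < x"
    moreover have "x \<noteq> y" using xy D pi by auto
    ultimately have "x < y" by simp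
    obtain i where i: "i < length xs" "xs ! i = x" using xy by (meson in_set_conv_nth)
    obtain k where k: "k < length ys" "ys ! k = y" using xy by (meson in_set_conv_nth)
    let ?j = "length xs" and ?k = "length xs + 1 + k"
    have "i < ?j \<and> ?j < ?k \<and> ?k < length \<pi> \<and> \<pi> ! i < \<pi> ! ?k \<and> \<pi> ! ?k < \<pi> ! ?j"
      using i k \<open>x < y\<close> lt[of y] xy by (simp add: pi nth_append)
    with V show False unfolding avoids132_def by blast
  qed
  have "(xs @ [n]) @ ys \<in> Av132 n" using assms pi by simp
  moreover have "\<And>x y. x \<in> set (xs @ [n]) \<Longrightarrow> y \<in> set ys \<Longrightarrow> y < x"
    using gt lt by auto
  ultimately obtain \<alpha>1 where a1: "\<alpha>1 \<in> Av132 (length \<alpha>1)" "ys \<in> Av132 (length ys)"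
      "(xs @ [n]) @ ys = \<alpha>1 \<ominus> ys"
    by (rule skew_decomposition) blast
  then have m: "xs @ [n] = map (\<lambda>x. x + length ys) \<alpha>1" by (simp add: skew_sum_def)
  then obtain \<alpha> m where am: "\<alpha>1 = \<alpha> @ [m]" by (cases \<alpha>1 rule: rev_cases) auto
  have "x < m" if "x \<in> set \<alpha>" for x
  proof -
    have "x + length ys \<in> set xs" "n = m + length ys" using m am that by auto
    then show ?thesis using lt[of "x + length ys"] by simp
  qed
  then have "\<alpha> \<in> Av132 (length \<alpha>)" "\<alpha>1 = \<alpha> \<oplus> [1]"
    using Av132_snoc_max[of \<alpha> m] a1(1) am by blast+
  then have "is_split_max \<pi> (\<alpha>, ys)"
    using a1 pi by (simp add: is_split_max_def)
  moreover have "q = (\<alpha>, ys)" if "is_split_max \<pi> q" for q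
    using split_max_unique[of \<pi> "fst q" "snd q" \<alpha> ys] that calculation by (auto simp: prod_eq_iff)
  ultimately show ?thesis by blast
qed

lemma filter_split:
  assumes "\<And>i k. i < k \<Longrightarrow> k < length zs \<Longrightarrow> \<not> P (zs ! i) \<Longrightarrow> \<not> P (zs ! k)"
  shows "zs = filter P zs @ filter (\<lambda>x. \<not> P x) zs"
  using assms
proof (induction zs)
  case (Cons z zs)
  have IH: "zs = filter P zs @ filter (\<lambda>x. \<not> P x) zs"
  proof (rule Cons.IH)
    fix i k assume "i < k" "k < length zs" "\<not> P (zs ! i)"
    then show "\<not> P (zs ! k)" using Cons.prems[of "Suc i" "Suc k"] by simp
  qed
  show ?case
  proof (cases "P z")
    case True
    then show ?thesis using IH by simp
  next
    case False
    have "\<not> P x" if x: "x \<in> set zs" for x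
    proof -
      obtain k where "k < length zs" "zs ! k = x" using x by (meson in_set_conv_nth)
      then show ?thesis using Cons.prems[of 0 "Suc k"] False by simp
    qed
    then have "filter P zs = []" "filter (\<lambda>x. \<not> P x) zs = zs"
      by (simp_all add: filter_empty_conv)
    then show ?thesis using False by simp
  qed
qed simp

lemma ex1_split_last:
  assumes "\<pi> \<in> Av132 n" "n \<ge> 1"
  shows "\<exists>!p. is_split_last \<pi> p"
proof -
  have S: "set \<pi> = {1..n}" and D: "distinct \<pi>" and V: "avoids132 \<pi>"
    using assms by (auto simp: Av132_iff)
  have "\<pi> \<noteq> []" using S assms by auto
  then obtain zs m where pi: "\<pi> = zs @ [m]" by (cases \<pi> rule: rev_cases) auto
  have "\<not> m < zs ! k" if "i < k" "k < length zs" "\<not> m < zs ! i" for i k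
  proof
    assume "m < zs ! k"
    moreover have "zs ! i \<noteq> m" using D pi that by auto
    ultimately have "i < k \<and> k < length zs \<and> length zs < length \<pi> \<and>
        \<pi> ! i < \<pi> ! length zs \<and> \<pi> ! length zs < \<pi> ! k"
      using that by (simp add: pi nth_append)
    with V show False unfolding avoids132_def by blast
  qed
  then have zs: "zs = filter (\<lambda>x. m < x) zs @ filter (\<lambda>x. \<not> m < x) zs"
    by (rule filter_split)
  define xs where "xs = filter (\<lambda>x. m < x) zs"
  define ys where "ys = filter (\<lambda>x. \<not> m < x) zs"
  have z: "zs = xs @ ys" using zs xs_def ys_def by simp
  have ylt: "y < m" if "y \<in> set ys" for y
  proof -
    have "y \<in> set zs" "\<not> m < y" using that by (auto simp: ys_def)
    moreover have "m \<notin> set zs" using D pi by simp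
    ultimately show ?thesis by (metis linorder_neqE_nat)
  qed
  have "xs @ (ys @ [m]) \<in> Av132 n" using assms pi z by simp
  moreover have "\<And>x y. x \<in> set xs \<Longrightarrow> y \<in> set (ys @ [m]) \<Longrightarrow> y < x"
    using ylt by (fastforce simp: xs_def)
  ultimately obtain \<alpha> where a: "\<alpha> \<in> Av132 (length \<alpha>)" "ys @ [m] \<in> Av132 (length (ys @ [m]))"
      "xs @ (ys @ [m]) = \<alpha> \<ominus> (ys @ [m])"
    by (rule skew_decomposition) blast
  have "ys \<in> Av132 (length ys)" "ys @ [m] = ys \<oplus> [1]"
    using Av132_snoc_max[OF a(2)] ylt by blast+
  then have "is_split_last \<pi> (\<alpha>, ys)"
    using a pi z by (simp add: is_split_last_def)
  moreover have "q = (\<alpha>, ys)" if "is_split_last \<pi> q" for q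
    using split_last_unique[of \<pi> "fst q" "snd q" \<alpha> ys] that calculation by (auto simp: prod_eq_iff)
  ultimately show ?thesis by blast
qed

lemma split_max_eqI:
  assumes "is_split_max \<pi> p" shows "split_max \<pi> = p"
  unfolding split_max_def
proof (rule the_equality)
  fix q assume "is_split_max \<pi> q"
  then show "q = p"
    using split_max_unique[of \<pi> "fst q" "snd q" "fst p" "snd p"] assms by (simp add: prod_eq_iff)
qed (rule assms)

lemma split_last_eqI:
  assumes "is_split_last \<pi> p" shows "split_last \<pi> = p"
  unfolding split_last_def
proof (rule the_equality)
  fix q assume "is_split_last \<pi> q"
  then show "q = p"
    using split_last_unique[of \<pi> "fst q" "snd q" "fst p" "snd p"] assms by (simp add: prod_eq_iff)
qed (rule assms)

lemma is_split_max_split_max: "\<pi> \<in> Av132 n \<Longrightarrow> n \<ge> 1 \<Longrightarrow> is_split_max \<pi> (split_max \<pi>)"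
  unfolding split_max_def by (rule theI') (rule ex1_split_max)

lemma split_max_shorter:
  assumes "\<pi> \<in> Av132 (length \<pi>)" "\<pi> \<noteq> []" "(\<alpha>, \<beta>) = split_max \<pi>"
  shows "length \<alpha> < length \<pi>" "length \<beta> < length \<pi>"
proof -
  have "is_split_max \<pi> (\<alpha>, \<beta>)"
    using is_split_max_split_max[OF assms(1)] assms(2,3) by (simp add: Suc_leI)
  then have "length \<pi> = length \<alpha> + 1 + length \<beta>"
    by (simp add: is_split_max_def direct_sum_def skew_sum_def)
  then show "length \<alpha> < length \<pi>" "length \<beta> < length \<pi>" by simp_all
qed

text \<open>The map is left unspecified outside nonempty \<open>132\<close>-avoiding permutations. In its last two
  cases \<open>split_last\<close> and \<open>split_max\<close> decompose the recursive values.\<close>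

function psi :: "nat list \<Rightarrow> nat list" where
  "psi \<pi> =
    (if \<pi> = [] \<or> \<pi> \<notin> Av132 (length \<pi>) then undefined
     else if \<pi> = [1] then [1]
     else let (\<alpha>, \<beta>) = split_max \<pi> in
       if \<alpha> = [] then [1] \<ominus> psi \<beta>
       else if \<beta> \<noteq> [] then
         let (\<gamma>, \<delta>) = split_last (psi \<beta>) in ((psi \<alpha> \<ominus> (\<delta> \<oplus> [1])) \<oplus> [1]) \<ominus> \<gamma>
       else
         let (\<gamma>, \<delta>) = split_max (psi \<alpha>) in ((\<gamma> \<oplus> [1]) \<oplus> [1]) \<ominus> \<delta>)"
  by pat_completeness auto
termination
  by (relation "measure length") (auto simp: split_max_shorter)

declare psi.simps [simp del]

end

theory Submission
  imports Defs
begin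

text \<open>
  All three statistics are additive over the two decompositions up to a boundary term:
  \<open>A((\<alpha> \<oplus> 1) \<ominus> \<beta>) = A(\<alpha>) + A(\<beta>) + \<bar>\<alpha>\<bar>\<close> for \<open>\<beta>\<close> nonempty, where the boundary term comes from the
  descent following the maximum, and \<open>B((\<alpha> \<oplus> 1) \<ominus> \<beta>) = B(\<alpha>) + B(\<beta>) + \<bar>\<gamma>\<bar>\<close> for
  \<open>\<alpha> = \<gamma> \<ominus> (\<delta> \<oplus> 1)\<close>, where the boundary term comes from the ascent to the maximum. In case (ii) both
  terms are the length of \<open>\<alpha>\<close>. For injectivity, write \<open>\<psi>(\<pi>) = (\<mu> \<oplus> 1) \<ominus> \<nu>\<close>: the three cases are
  told apart by whether \<open>\<mu>\<close> is empty, ends in its maximum, or neither, and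
  in each case the recursive values can be read off.
\<close>

section \<open>The statistics of concatenations\<close>

lemma des_Nil [simp]: "des [] = 0"
  by (simp add: des_def)

lemma des_singleton [simp]: "des [a] = 0"
  by (simp add: des_def)

lemma stat_A_Nil [simp]: "stat_A [] = 0"
  by (simp add: stat_A_def)

lemma stat_A_singleton [simp]: "stat_A [a] = 0"
  by (simp add: stat_A_def)

lemma stat_B_Nil [simp]: "stat_B [] = 0"
  by (simp add: stat_B_def)

lemma stat_B_singleton [simp]: "stat_B [a] = 0"
  by (simp add: stat_B_def)

lemma des_snoc_snoc:
  "des (xs @ [a, b]) = des (xs @ [a]) + (if b < a then 1 else 0)"
proof -
  let ?D = "\<lambda>zs::nat list. {i. i + 1 < length zs \<and> zs ! i > zs ! (i + 1)}"
  have fin: "finite (?D (xs @ [a]))"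
    by (rule finite_subset[of _ "{..length xs}"]) auto
  have "?D (xs @ [a, b]) = ?D (xs @ [a]) \<union> (if b < a then {length xs} else {})"
    by (auto simp: nth_append less_Suc_eq)
  then show ?thesis
    using fin by (simp add: des_def card_insert_if)
qed

text \<open>A common recursion for \<open>stat_A\<close> and \<open>stat_B\<close>, which differ
  only in the condition on the three entries; \<open>R\<close> takes them in the order
  \<open>\<pi> ! j\<close>, \<open>\<pi> ! i\<close>, \<open>\<pi> ! (j + 1)\<close>.\<close>

lemma card_pairs_snoc_snoc:
  fixes R :: "'a \<Rightarrow> 'a \<Rightarrow> 'a \<Rightarrow> bool" and xs :: "'a list"
  defines "S \<equiv> \<lambda>zs. {(i, j). i < j \<and> j + 1 < length zs \<and> R (zs ! j) (zs ! i) (zs ! (j + 1))}"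
  shows "card (S (xs @ [a, b])) = card (S (xs @ [a])) + length (filter (\<lambda>x. R a x b) xs)"
proof -
  \<comment> \<open>Appending \<open>b\<close> creates one new adjacent pair of positions, the one
    holding \<open>a\<close> and \<open>b\<close>, so every new pair has second component
    \<open>length xs\<close>.\<close>
  let ?T = "{i. i < length xs \<and> R a (xs ! i) b} \<times> {length xs}"
  have fin: "finite (S zs)" for zs
    by (rule finite_subset[of _ "{..length zs} \<times> {..length zs}"]) (auto simp: S_def)
  have "S (xs @ [a, b]) = S (xs @ [a]) \<union> ?T"
    by (auto simp: S_def nth_append less_Suc_eq)
  moreover have "S (xs @ [a]) \<inter> ?T = {}"
    by (auto simp: S_def)
  ultimately have "card (S (xs @ [a, b])) = card (S (xs @ [a])) + card ?T"
    using fin by (simp add: card_Un_disjoint)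
  then show ?thesis
    by (simp add: card_cartesian_product length_filter_conv_card)
qed

lemma stat_A_snoc_snoc:
  "stat_A (xs @ [a, b]) = stat_A (xs @ [a]) + length (filter (\<lambda>x. b < x \<and> x < a) xs)"
  unfolding stat_A_def using card_pairs_snoc_snoc[where R = "\<lambda>a x b. b < x \<and> x < a"] by simp

lemma stat_B_snoc_snoc:
  "stat_B (xs @ [a, b]) = stat_B (xs @ [a]) + length (filter (\<lambda>x. a < x \<and> x < b) xs)"
  unfolding stat_B_def using card_pairs_snoc_snoc[where R = "\<lambda>a x b. a < x \<and> x < b"] by simp

text \<open>The recursions for the statistics speak of the last two entries, so the empty and the
  one-entry list are both base cases.\<close>

lemma snoc_snoc_induct [case_names Nil singleton snoc]:
  assumes "P []" "\<And>a. P [a]" "\<And>xs a b. P (xs @ [a]) \<Longrightarrow> P (xs @ [a, b])"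
  shows "P xs"
proof (induction xs rule: rev_induct)
  case (snoc b xs)
  then show ?case
    using assms(2)[of b] assms(3)[of "butlast xs" "last xs" b]
    by (cases xs rule: rev_cases) auto
qed (rule assms(1))

lemma stats_shift [simp]:
  "des (map (\<lambda>x. x + k) xs) = des xs"
  "stat_A (map (\<lambda>x. x + k) xs) = stat_A xs"
  "stat_B (map (\<lambda>x. x + k) xs) = stat_B xs"
  by (induction xs rule: snoc_snoc_induct)
    (simp_all add: des_snoc_snoc stat_A_snoc_snoc stat_B_snoc_snoc filter_map o_def)

lemma filter_False_append:
  assumes "\<And>x. x \<in> set xs \<Longrightarrow> \<not> P x"
  shows "filter P (xs @ ys) = filter P ys"
  using assms by (simp add: filter_empty_conv)

lemma des_append_greater:
  assumes "\<And>x y. x \<in> set xs \<Longrightarrow> y \<in> set ys \<Longrightarrow> y < x"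
  shows "des (xs @ ys) = des xs + des ys + (if xs = [] \<or> ys = [] then 0 else 1)"
  using assms
proof (induction ys rule: snoc_snoc_induct)
  case (singleton b)
  then show ?case
    by (cases xs rule: rev_cases) (simp_all add: des_snoc_snoc)
next
  case (snoc ys a b)
  have "\<And>x y. x \<in> set xs \<Longrightarrow> y \<in> set (ys @ [a]) \<Longrightarrow> y < x"
    using snoc.prems by auto
  note IH = snoc.IH[OF this]
  show ?case
    using des_snoc_snoc[of "xs @ ys" a b] IH by (simp add: des_snoc_snoc)
qed simp

text \<open>A descent inside \<open>ys\<close> lies below all of \<open>xs\<close> and encloses none
  of its entries. The only mixed contribution is the descent from \<open>last xs\<close> to the
  first entry of \<open>ys\<close>; its lower bound holds for all of \<open>xs\<close>, which leaves
  the condition \<open>x < last xs\<close>.\<close>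

lemma stat_A_append_greater:
  assumes "\<And>x y. x \<in> set xs \<Longrightarrow> y \<in> set ys \<Longrightarrow> y < x"
  shows "stat_A (xs @ ys) = stat_A xs + stat_A ys +
    (if xs = [] \<or> ys = [] then 0 else length (filter (\<lambda>x. x < last xs) xs))"
  using assms
proof (induction ys rule: snoc_snoc_induct)
  case (singleton b)
  then show ?case
    by (cases xs rule: rev_cases)
      (auto simp: stat_A_snoc_snoc intro!: arg_cong[where f = length] filter_cong)
next
  case (snoc ys a b)
  have "filter (\<lambda>x. b < x \<and> x < a) (xs @ ys) = filter (\<lambda>x. b < x \<and> x < a) ys"
    by (rule filter_False_append) (use snoc.prems in fastforce)
  moreover have "\<And>x y. x \<in> set xs \<Longrightarrow> y \<in> set (ys @ [a]) \<Longrightarrow> y < x"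
    using snoc.prems by auto
  note IH = snoc.IH[OF this]
  ultimately show ?case
    using stat_A_snoc_snoc[of "xs @ ys" a b] IH by (simp add: stat_A_snoc_snoc)
qed simp

text \<open>The step from \<open>xs\<close> to \<open>ys\<close> is a descent, which
  \<open>stat_B\<close> ignores, and an ascent inside \<open>ys\<close> lies below all of
  \<open>xs\<close>.\<close>

lemma stat_B_append_greater:
  assumes "\<And>x y. x \<in> set xs \<Longrightarrow> y \<in> set ys \<Longrightarrow> y < x"
  shows "stat_B (xs @ ys) = stat_B xs + stat_B ys"
  using assms
proof (induction ys rule: snoc_snoc_induct)
  case (singleton b)
  then show ?case
    by (cases xs rule: rev_cases) (fastforce simp: stat_B_snoc_snoc filter_empty_conv)+
next
  case (snoc ys a b)
  have "filter (\<lambda>x. a < x \<and> x < b) (xs @ ys) = filter (\<lambda>x. a < x \<and> x < b) ys"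
    by (rule filter_False_append) (use snoc.prems in fastforce)
  moreover have "\<And>x y. x \<in> set xs \<Longrightarrow> y \<in> set (ys @ [a]) \<Longrightarrow> y < x"
    using snoc.prems by auto
  note IH = snoc.IH[OF this]
  ultimately show ?case
    using stat_B_snoc_snoc[of "xs @ ys" a b] IH by (simp add: stat_B_snoc_snoc)
qed simp

text \<open>The step to a new maximum is an ascent, so only \<open>stat_B\<close> changes: the step
  encloses exactly the entries above \<open>last xs\<close>. For empty \<open>xs\<close> the
  unspecified \<open>last xs\<close> is harmless, as the filtered list is empty.\<close>

lemma stats_snoc_max:
  assumes "\<And>x. x \<in> set xs \<Longrightarrow> x < m"
  shows "des (xs @ [m]) = des xs"
    and "stat_A (xs @ [m]) = stat_A xs"
    and "stat_B (xs @ [m]) = stat_B xs + length (filter (\<lambda>x. last xs < x) xs)"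
proof -
  have "des (xs @ [m]) = des xs \<and> stat_A (xs @ [m]) = stat_A xs \<and>
    stat_B (xs @ [m]) = stat_B xs + length (filter (\<lambda>x. last xs < x) xs)"
  proof (cases xs rule: rev_cases)
    case (snoc ys a)
    have "filter (\<lambda>x. m < x \<and> x < a) ys = []" "a < m"
      "filter (\<lambda>x. a < x \<and> x < m) ys = filter (\<lambda>x. a < x) ys"
      using assms snoc by (fastforce simp: filter_empty_conv intro: filter_cong)+
    then show ?thesis
      by (simp add: snoc des_snoc_snoc stat_A_snoc_snoc stat_B_snoc_snoc)
  qed simp
  then show "des (xs @ [m]) = des xs" "stat_A (xs @ [m]) = stat_A xs"
    "stat_B (xs @ [m]) = stat_B xs + length (filter (\<lambda>x. last xs < x) xs)"
    by blast+
qed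

section \<open>Sums of 132-avoiding permutations\<close>

text \<open>Membership in \<open>Av132\<close> without the length index, so that sums can be treated
  without tracking lengths.\<close>

definition perm132 :: "nat list \<Rightarrow> bool" where
  "perm132 \<pi> \<longleftrightarrow> \<pi> \<in> Av132 (length \<pi>)"

lemma Av132_eq: "\<pi> \<in> Av132 n \<longleftrightarrow> perm132 \<pi> \<and> length \<pi> = n"
  using Av132_length perm132_def by blast

lemma perm132_iff: "perm132 \<pi> \<longleftrightarrow> set \<pi> = {1..length \<pi>} \<and> distinct \<pi> \<and> avoids132 \<pi>"
  by (simp add: perm132_def Av132_iff)

(* The entry 1 of the singleton permutation should not be rewritten to Suc 0. *)
declare One_nat_def [simp del]

lemma length_direct_sum [simp]: "length (\<alpha> \<oplus> \<beta>) = length \<alpha> + length \<beta>"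
  by (simp add: direct_sum_def)

lemma length_skew_sum [simp]: "length (\<alpha> \<ominus> \<beta>) = length \<alpha> + length \<beta>"
  by (simp add: skew_sum_def)

lemma direct_sum_Nil [simp]: "[] \<oplus> \<beta> = \<beta>"
  by (simp add: direct_sum_def)

lemma skew_sum_Nil [simp]: "[] \<ominus> \<beta> = \<beta>" "\<alpha> \<ominus> [] = \<alpha>"
  by (simp_all add: skew_sum_def)

lemma direct_sum_one_neq_Nil [simp]: "\<alpha> \<oplus> [1] \<noteq> []" "[] \<noteq> \<alpha> \<oplus> [1]"
  by (simp_all add: direct_sum_def)

lemma skew_sum_eq_Nil_iff [simp]:
  "\<alpha> \<ominus> \<beta> = [] \<longleftrightarrow> \<alpha> = [] \<and> \<beta> = []"
  "[] = \<alpha> \<ominus> \<beta> \<longleftrightarrow> \<alpha> = [] \<and> \<beta> = []"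
  by (auto simp: skew_sum_def)

lemma perm132_less: "perm132 \<alpha> \<Longrightarrow> x \<in> set \<alpha> \<Longrightarrow> x < length \<alpha> + 1"
  by (auto simp: perm132_iff)

lemma perm132_Nil [simp]: "perm132 []"
  by (simp add: perm132_iff avoids132_def)

lemma avoids132_shift_iff [simp]: "avoids132 (map (\<lambda>x. x + b) xs) \<longleftrightarrow> avoids132 xs"
proof
  assume "avoids132 xs"
  then show "avoids132 (map (\<lambda>x. x + b) xs)"
    unfolding avoids132_def by (force dest: less_trans)
qed (rule avoids132_shift)

text \<open>The appended entry is last, so it could only play the 2 of a 132, but it is the maximum
  and no entry can play the 3.\<close>

lemma perm132_direct_sum_one [simp, intro]:
  assumes "perm132 \<alpha>"
  shows "perm132 (\<alpha> \<oplus> [1])"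
proof -
  have S: "set \<alpha> = {1..length \<alpha>}" "distinct \<alpha>" "avoids132 \<alpha>"
    using assms by (auto simp: perm132_iff)
  have le: "\<alpha> ! i \<le> length \<alpha>" if "i < length \<alpha>" for i
    using nth_mem[OF that] S(1) by simp
  have "avoids132 (\<alpha> @ [1 + length \<alpha>])"
    unfolding avoids132_def
  proof (intro notI, elim exE conjE)
    fix i j k
    let ?\<pi> = "\<alpha> @ [1 + length \<alpha>]"
    assume *: "i < j" "j < k" "k < length ?\<pi>" "?\<pi> ! i < ?\<pi> ! k" "?\<pi> ! k < ?\<pi> ! j"
    show False
    proof (cases "k < length \<alpha>")
      case True
      then show False
        using * S(3) unfolding avoids132_def by (auto simp: nth_append)
    next
      case False
      then have "k = length \<alpha>" using * by simp
      then show False using * le[of j] by (simp add: nth_append)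
    qed
  qed
  then show ?thesis
    using S by (auto simp: perm132_iff direct_sum_def)
qed

text \<open>The last entry of a 132 exceeds the first, while every entry of the right block is below
  every entry of the left one. An occurrence therefore lies within a single block.\<close>

lemma perm132_skew_sum [simp, intro]:
  assumes "perm132 \<alpha>" "perm132 \<beta>"
  shows "perm132 (\<alpha> \<ominus> \<beta>)"
proof -
  let ?xs = "map (\<lambda>x. x + length \<beta>) \<alpha>"
  have S: "set \<alpha> = {1..length \<alpha>}" "distinct \<alpha>" "avoids132 ?xs"
    "set \<beta> = {1..length \<beta>}" "distinct \<beta>" "avoids132 \<beta>"
    using assms by (auto simp: perm132_iff)
  have gt: "y < x" if "x \<in> set ?xs" "y \<in> set \<beta>" for x y
    using that S by fastforce
  have "avoids132 (?xs @ \<beta>)"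
    unfolding avoids132_def
  proof (intro notI, elim exE conjE)
    fix i j k
    let ?\<pi> = "?xs @ \<beta>" and ?a = "length ?xs"
    assume *: "i < j" "j < k" "k < length ?\<pi>" "?\<pi> ! i < ?\<pi> ! k" "?\<pi> ! k < ?\<pi> ! j"
    consider "k < ?a" | "i < ?a" "?a \<le> k" | "?a \<le> i"
      by linarith
    then show False
    proof cases
      case 1
      then have "i < j" "j < k" "k < ?a" "?xs ! i < ?xs ! k" "?xs ! k < ?xs ! j"
        using * by (auto simp: nth_append)
      then show False
        using S(3) unfolding avoids132_def by blast
    next
      case 2
      moreover have "k - ?a < length \<beta>" using * 2 by auto
      ultimately have "?\<pi> ! k < ?\<pi> ! i"
        using gt[OF nth_mem[of i ?xs] nth_mem[of "k - ?a" \<beta>]] by (simp add: nth_append)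
      then show False using * by simp
    next
      case 3
      then have "i - ?a < j - ?a" "j - ?a < k - ?a" "k - ?a < length \<beta>"
        "\<beta> ! (i - ?a) < \<beta> ! (k - ?a)" "\<beta> ! (k - ?a) < \<beta> ! (j - ?a)"
        using * by (auto simp: nth_append)
      then show False
        using S(6) unfolding avoids132_def by blast
    qed
  qed
  moreover have "set (?xs @ \<beta>) = {1..length \<alpha> + length \<beta>}"
  proof -
    have "set ?xs = {1 + length \<beta>..length \<alpha> + length \<beta>}"
      using S(1) image_add_atLeastAtMost'[of "length \<beta>" 1 "length \<alpha>"] by simp
    then show ?thesis
      using S(4) by auto
  qed
  moreover have "distinct (?xs @ \<beta>)"
    using S gt by (fastforce simp: distinct_map inj_on_def)
  ultimately show ?thesis
    by (simp add: perm132_iff skew_sum_def)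
qed

lemma perm132_one [simp]: "perm132 [1]"
  using perm132_direct_sum_one[of "[]"] by simp

section \<open>Uniqueness and existence of the two decompositions\<close>

lemma split_max_sum [simp]:
  "perm132 \<alpha> \<Longrightarrow> perm132 \<beta> \<Longrightarrow> split_max ((\<alpha> \<oplus> [1]) \<ominus> \<beta>) = (\<alpha>, \<beta>)"
  by (rule split_max_eqI) (simp add: is_split_max_def perm132_def)

lemma split_last_sum [simp]:
  "perm132 \<alpha> \<Longrightarrow> perm132 \<beta> \<Longrightarrow> split_last (\<alpha> \<ominus> (\<beta> \<oplus> [1])) = (\<alpha>, \<beta>)"
  by (rule split_last_eqI) (simp add: is_split_last_def perm132_def)

lemma max_sum_eq_iff:
  assumes "perm132 \<alpha>" "perm132 \<beta>" "perm132 \<alpha>'" "perm132 \<beta>'"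
  shows "(\<alpha> \<oplus> [1]) \<ominus> \<beta> = (\<alpha>' \<oplus> [1]) \<ominus> \<beta>' \<longleftrightarrow> \<alpha> = \<alpha>' \<and> \<beta> = \<beta>'"
  using assms split_max_sum[of \<alpha> \<beta>] split_max_sum[of \<alpha>' \<beta>'] by (metis prod.inject)

lemma last_sum_eq_iff:
  assumes "perm132 \<alpha>" "perm132 \<beta>" "perm132 \<alpha>'" "perm132 \<beta>'"
  shows "\<alpha> \<ominus> (\<beta> \<oplus> [1]) = \<alpha>' \<ominus> (\<beta>' \<oplus> [1]) \<longleftrightarrow> \<alpha> = \<alpha>' \<and> \<beta> = \<beta>'"
  using assms split_last_sum[of \<alpha> \<beta>] split_last_sum[of \<alpha>' \<beta>'] by (metis prod.inject)

lemma perm132_max_decomposition: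
  assumes "perm132 \<pi>" "\<pi> \<noteq> []"
  obtains \<alpha> \<beta> where "perm132 \<alpha>" "perm132 \<beta>" "\<pi> = (\<alpha> \<oplus> [1]) \<ominus> \<beta>"
proof -
  have "1 \<le> length \<pi>"
    using assms(2) by (simp add: Suc_leI One_nat_def)
  then obtain p where "is_split_max \<pi> p"
    using ex1_split_max assms(1) unfolding perm132_def by blast
  then show ?thesis
    using that[of "fst p" "snd p"] by (auto simp: is_split_max_def perm132_def)
qed

lemma perm132_last_decomposition:
  assumes "perm132 \<pi>" "\<pi> \<noteq> []"
  obtains \<alpha> \<beta> where "perm132 \<alpha>" "perm132 \<beta>" "\<pi> = \<alpha> \<ominus> (\<beta> \<oplus> [1])"
proof -
  have "1 \<le> length \<pi>"
    using assms(2) by (simp add: Suc_leI One_nat_def)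
  then obtain p where "is_split_last \<pi> p"
    using ex1_split_last assms(1) unfolding perm132_def by blast
  then show ?thesis
    using that[of "fst p" "snd p"] by (auto simp: is_split_last_def perm132_def)
qed

section \<open>The statistics of direct and skew sums\<close>

lemma
  assumes "perm132 \<alpha>" "perm132 \<beta>"
  shows des_skew_sum: "des (\<alpha> \<ominus> \<beta>) = des \<alpha> + des \<beta> + (if \<alpha> = [] \<or> \<beta> = [] then 0 else 1)"
    and stat_A_skew_sum: "stat_A (\<alpha> \<ominus> \<beta>) = stat_A \<alpha> + stat_A \<beta> +
      (if \<alpha> = [] \<or> \<beta> = [] then 0 else length (filter (\<lambda>x. x < last \<alpha>) \<alpha>))"
    and stat_B_skew_sum: "stat_B (\<alpha> \<ominus> \<beta>) = stat_B \<alpha> + stat_B \<beta>"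
proof -
  have gt: "y < x" if "x \<in> set (map (\<lambda>x. x + length \<beta>) \<alpha>)" "y \<in> set \<beta>" for x y
    using that assms by (fastforce simp: perm132_iff)
  show "des (\<alpha> \<ominus> \<beta>) = des \<alpha> + des \<beta> + (if \<alpha> = [] \<or> \<beta> = [] then 0 else 1)"
    unfolding skew_sum_def by (subst des_append_greater[OF gt]) simp_all
  show "stat_A (\<alpha> \<ominus> \<beta>) = stat_A \<alpha> + stat_A \<beta> +
      (if \<alpha> = [] \<or> \<beta> = [] then 0 else length (filter (\<lambda>x. x < last \<alpha>) \<alpha>))"
    unfolding skew_sum_def
    by (subst stat_A_append_greater[OF gt]) (simp_all add: filter_map o_def last_map)
  show "stat_B (\<alpha> \<ominus> \<beta>) = stat_B \<alpha> + stat_B \<beta>"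
    unfolding skew_sum_def by (subst stat_B_append_greater[OF gt]) simp_all
qed

lemma
  assumes "perm132 \<alpha>"
  shows des_direct_sum_one: "des (\<alpha> \<oplus> [1]) = des \<alpha>"
    and stat_A_direct_sum_one: "stat_A (\<alpha> \<oplus> [1]) = stat_A \<alpha>"
    and stat_B_direct_sum_one:
      "stat_B (\<alpha> \<oplus> [1]) = stat_B \<alpha> + length (filter (\<lambda>x. last \<alpha> < x) \<alpha>)"
proof -
  have "x < 1 + length \<alpha>" if "x \<in> set \<alpha>" for x
    using perm132_less[OF assms that] by simp
  note eqs = stats_snoc_max[OF this]
  show "des (\<alpha> \<oplus> [1]) = des \<alpha>" "stat_A (\<alpha> \<oplus> [1]) = stat_A \<alpha>"
    "stat_B (\<alpha> \<oplus> [1]) = stat_B \<alpha> + length (filter (\<lambda>x. last \<alpha> < x) \<alpha>)"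
    using eqs by (simp_all add: direct_sum_def)
qed

lemma last_direct_sum_one: "last (\<alpha> \<oplus> [1]) = length \<alpha> + 1"
  by (simp add: direct_sum_def)

text \<open>The last entry of \<open>\<alpha> \<oplus> [1]\<close> is its maximum, so the descent
  into a nonempty \<open>\<beta>\<close> encloses all entries coming from
  \<open>\<alpha>\<close>.\<close>

lemma stat_A_max_sum:
  assumes "perm132 \<alpha>" "perm132 \<beta>"
  shows "stat_A ((\<alpha> \<oplus> [1]) \<ominus> \<beta>) =
    stat_A \<alpha> + stat_A \<beta> + (if \<beta> = [] then 0 else length \<alpha>)"
proof -
  have "filter (\<lambda>x. x < length \<alpha> + 1) (\<alpha> \<oplus> [1]) = \<alpha>"
    using perm132_less[OF assms(1)] by (simp add: direct_sum_def)
  then show ?thesis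
    using assms
    by (simp add: stat_A_skew_sum stat_A_direct_sum_one last_direct_sum_one)
qed

text \<open>The last entry before the new maximum lies above the entries of \<open>\<delta>\<close>
  and below the shifted entries of \<open>\<gamma>\<close>, so the final ascent encloses exactly the
  latter.\<close>

lemma stat_B_last_sum_direct_sum_one:
  assumes "perm132 \<gamma>" "perm132 \<delta>"
  shows "stat_B ((\<gamma> \<ominus> (\<delta> \<oplus> [1])) \<oplus> [1]) = stat_B (\<gamma> \<ominus> (\<delta> \<oplus> [1])) + length \<gamma>"
proof -
  have "last (\<gamma> \<ominus> (\<delta> \<oplus> [1])) = length \<delta> + 1"
    by (simp add: skew_sum_def direct_sum_def)
  moreover have "filter (\<lambda>x. length \<delta> + 1 < x) (\<gamma> \<ominus> (\<delta> \<oplus> [1])) =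
      map (\<lambda>x. x + (length \<delta> + 1)) \<gamma>"
    using assms by (auto simp: skew_sum_def direct_sum_def filter_empty_conv perm132_iff
        intro!: filter_True)
  ultimately show ?thesis
    using assms by (simp add: stat_B_direct_sum_one)
qed

section \<open>The graph of the map\<close>

text \<open>The graph of \<open>psi\<close>, with the pieces of the recursive values written out
  instead of obtained from \<open>split_max\<close> and \<open>split_last\<close>. This gives rule
  induction and inversion for all later arguments. The premises on \<open>\<gamma>\<close> and
  \<open>\<delta>\<close> make them the parts of the unique decompositions.\<close>

inductive psi_rel :: "nat list \<Rightarrow> nat list \<Rightarrow> bool" where
  one: "psi_rel [1] [1]"
| max_first: "psi_rel \<alpha> \<alpha>' \<Longrightarrow> psi_rel ([1] \<ominus> \<alpha>) ([1] \<ominus> \<alpha>')"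
| max_middle: "psi_rel \<alpha> \<alpha>' \<Longrightarrow> psi_rel \<beta> (\<gamma> \<ominus> (\<delta> \<oplus> [1])) \<Longrightarrow> perm132 \<gamma> \<Longrightarrow> perm132 \<delta> \<Longrightarrow>
    psi_rel ((\<alpha> \<oplus> [1]) \<ominus> \<beta>) (((\<alpha>' \<ominus> (\<delta> \<oplus> [1])) \<oplus> [1]) \<ominus> \<gamma>)"
| max_last: "psi_rel \<alpha> ((\<gamma> \<oplus> [1]) \<ominus> \<delta>) \<Longrightarrow> perm132 \<gamma> \<Longrightarrow> perm132 \<delta> \<Longrightarrow>
    psi_rel (\<alpha> \<oplus> [1]) (((\<gamma> \<oplus> [1]) \<oplus> [1]) \<ominus> \<delta>)"

lemma psi_rel_perm132:
  "psi_rel \<pi> \<sigma> \<Longrightarrow> perm132 \<pi> \<and> perm132 \<sigma> \<and> \<pi> \<noteq> [] \<and> \<sigma> \<noteq> [] \<and> length \<sigma> = length \<pi>"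
proof (induction rule: psi_rel.induct)
  case one
  then show ?case using perm132_one by simp
next
  case (max_first \<alpha> \<alpha>')
  then show ?case by auto
next
  case (max_middle \<alpha> \<alpha>' \<beta> \<gamma> \<delta>)
  then show ?case by auto
next
  case (max_last \<alpha> \<gamma> \<delta>)
  then show ?case by auto
qed

lemma psi_max_sum:
  assumes "perm132 \<alpha>" "perm132 \<beta>" "\<alpha> \<noteq> [] \<or> \<beta> \<noteq> []"
  shows "psi ((\<alpha> \<oplus> [1]) \<ominus> \<beta>) =
    (if \<alpha> = [] then [1] \<ominus> psi \<beta>
     else if \<beta> \<noteq> [] then
       let (\<gamma>, \<delta>) = split_last (psi \<beta>) in ((psi \<alpha> \<ominus> (\<delta> \<oplus> [1])) \<oplus> [1]) \<ominus> \<gamma>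
     else let (\<gamma>, \<delta>) = split_max (psi \<alpha>) in ((\<gamma> \<oplus> [1]) \<oplus> [1]) \<ominus> \<delta>)"
proof -
  \<comment> \<open>Comparing lengths excludes the base case of the recursion.\<close>
  have "length ((\<alpha> \<oplus> [1]) \<ominus> \<beta>) \<noteq> length [1::nat]"
    using assms(3) by auto
  then have "(\<alpha> \<oplus> [1]) \<ominus> \<beta> \<noteq> [1]"
    by metis
  moreover have "perm132 ((\<alpha> \<oplus> [1]) \<ominus> \<beta>)"
    using assms by simp
  ultimately show ?thesis
    using assms by (subst psi.simps[folded perm132_def]) simp
qed

lemma psi_rel_psi: "perm132 \<pi> \<Longrightarrow> \<pi> \<noteq> [] \<Longrightarrow> psi_rel \<pi> (psi \<pi>)"
proof (induction "length \<pi>" arbitrary: \<pi> rule: less_induct)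
  case less
  obtain \<alpha> \<beta> where ab: "perm132 \<alpha>" "perm132 \<beta>" and pi: "\<pi> = (\<alpha> \<oplus> [1]) \<ominus> \<beta>"
    using perm132_max_decomposition less.prems by blast
  have IH: "\<alpha> \<noteq> [] \<Longrightarrow> psi_rel \<alpha> (psi \<alpha>)" "\<beta> \<noteq> [] \<Longrightarrow> psi_rel \<beta> (psi \<beta>)"
    using less.hyps[of \<alpha>] less.hyps[of \<beta>] ab pi by simp_all
  consider "\<alpha> = []" "\<beta> = []" | "\<alpha> = []" "\<beta> \<noteq> []" | "\<alpha> \<noteq> []" "\<beta> \<noteq> []" | "\<alpha> \<noteq> []" "\<beta> = []"
    by blast
  then show ?case
  proof cases
    case 1
    then have "\<pi> = [1]" by (simp add: pi)
    moreover have "psi [1] = [1]"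
      using perm132_one by (subst psi.simps[folded perm132_def]) simp
    ultimately show ?thesis using psi_rel.one by simp
  next
    case 2
    then have "psi \<pi> = [1] \<ominus> psi \<beta>" "\<pi> = [1] \<ominus> \<beta>"
      using psi_max_sum[OF ab] by (simp_all add: pi)
    then show ?thesis
      using psi_rel.max_first[OF IH(2)] 2 by simp
  next
    case 3
    \<comment> \<open>By the induction hypothesis the recursive value is related to
      \<open>\<beta>\<close>, hence nonempty and 132-avoiding, which is what a decomposition
      requires.\<close>
    obtain \<gamma> \<delta> where cd: "perm132 \<gamma>" "perm132 \<delta>" "psi \<beta> = \<gamma> \<ominus> (\<delta> \<oplus> [1])"
      using psi_rel_perm132[OF IH(2)] 3 perm132_last_decomposition by metis
    then have "psi \<pi> = ((psi \<alpha> \<ominus> (\<delta> \<oplus> [1])) \<oplus> [1]) \<ominus> \<gamma>"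
      using psi_max_sum[OF ab] 3 by (simp add: pi)
    then show ?thesis
      unfolding pi using psi_rel.max_middle[OF IH(1)] IH(2) cd 3 by metis
  next
    case 4
    obtain \<gamma> \<delta> where cd: "perm132 \<gamma>" "perm132 \<delta>" "psi \<alpha> = (\<gamma> \<oplus> [1]) \<ominus> \<delta>"
      using psi_rel_perm132[OF IH(1)] 4 perm132_max_decomposition by metis
    then have "psi \<pi> = ((\<gamma> \<oplus> [1]) \<oplus> [1]) \<ominus> \<delta>"
      using psi_max_sum[OF ab] 4 by (simp add: pi)
    then show ?thesis
      unfolding pi using psi_rel.max_last[of \<alpha> \<gamma> \<delta>] IH(1) cd 4 by simp
  qed
qed

section \<open>Preservation of the statistics and injectivity\<close>

lemma psi_rel_des: "psi_rel \<pi> \<sigma> \<Longrightarrow> des \<sigma> = des \<pi>"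
proof (induction rule: psi_rel.induct)
  case (max_first \<alpha> \<alpha>')
  then show ?case
    using psi_rel_perm132[OF max_first.hyps]
    by (simp add: des_skew_sum perm132_one)
next
  \<comment> \<open>The descent after the maximum of the argument corresponds to the one between
    \<open>\<alpha>'\<close> and \<open>\<delta> \<oplus> [1]\<close>. If \<open>\<gamma>\<close> is
    nonempty, the descent from \<open>\<gamma>\<close> into \<open>\<delta> \<oplus> [1]\<close> is
    replaced by the one from the new maximum into \<open>\<gamma>\<close>.\<close>
  case (max_middle \<alpha> \<alpha>' \<beta> \<gamma> \<delta>)
  then show ?case
    using psi_rel_perm132[OF max_middle.hyps(1)] psi_rel_perm132[OF max_middle.hyps(2)]
    by (simp add: des_skew_sum des_direct_sum_one split: if_splits)
next
  case (max_last \<alpha> \<gamma> \<delta>)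
  then show ?case
    using psi_rel_perm132[OF max_last.hyps(1)]
    by (simp add: des_skew_sum des_direct_sum_one)
qed simp

lemma psi_rel_stat: "psi_rel \<pi> \<sigma> \<Longrightarrow> stat_B \<sigma> = stat_A \<pi>"
proof (induction rule: psi_rel.induct)
  \<comment> \<open>The boundary term of \<open>stat_A\<close> vanishes, since \<open>[1]\<close>
    has no entry below its last one.\<close>
  case (max_first \<alpha> \<alpha>')
  then show ?case
    using psi_rel_perm132[OF max_first.hyps]
    by (simp add: stat_A_skew_sum stat_B_skew_sum perm132_one)
next
  \<comment> \<open>The contributions of \<open>\<gamma>\<close> and
    \<open>\<delta> \<oplus> [1]\<close> add up to \<open>stat_B\<close> of the value at
    \<open>\<beta>\<close>, although the two blocks are now separated. The boundary terms
    \<open>length \<alpha>\<close> and \<open>length \<alpha>'\<close> agree.\<close>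
  case (max_middle \<alpha> \<alpha>' \<beta> \<gamma> \<delta>)
  then show ?case
    using psi_rel_perm132[OF max_middle.hyps(1)] psi_rel_perm132[OF max_middle.hyps(2)]
    by (simp add: stat_A_max_sum stat_B_skew_sum stat_B_last_sum_direct_sum_one)
next
  case (max_last \<alpha> \<gamma> \<delta>)
  \<comment> \<open>With an empty first block, the ascent between the two largest entries encloses
    nothing.\<close>
  have "stat_B ((\<gamma> \<oplus> [1]) \<oplus> [1]) = stat_B (\<gamma> \<oplus> [1])"
    using stat_B_last_sum_direct_sum_one[of "[]" \<gamma>] max_last.hyps by simp
  with max_last show ?case
    using psi_rel_perm132[OF max_last.hyps(1)]
    by (simp add: stat_A_direct_sum_one stat_B_skew_sum)
qed simp

text \<open>Inversion for a value in its decomposition at the maximum. Each clause of the relation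
  produces a value of this shape, and uniqueness of the decomposition identifies
  \<open>\<mu>\<close> and \<open>\<nu>\<close>.\<close>

lemma psi_rel_cases_max_sum [consumes 3]:
  assumes "psi_rel \<pi> ((\<mu> \<oplus> [1]) \<ominus> \<nu>)" and \<mu>: "perm132 \<mu>" and \<nu>: "perm132 \<nu>"
  obtains (one) "\<mu> = []" "\<nu> = []" "\<pi> = [1]"
  | (max_first) \<alpha> where "\<mu> = []" "\<nu> \<noteq> []" "psi_rel \<alpha> \<nu>" "\<pi> = [1] \<ominus> \<alpha>"
  | (max_middle) \<alpha> \<alpha>' \<beta> \<delta> where "\<mu> = \<alpha>' \<ominus> (\<delta> \<oplus> [1])" "\<alpha>' \<noteq> []" "perm132 \<alpha>'" "perm132 \<delta>"
      "psi_rel \<alpha> \<alpha>'" "psi_rel \<beta> (\<nu> \<ominus> (\<delta> \<oplus> [1]))" "\<pi> = (\<alpha> \<oplus> [1]) \<ominus> \<beta>"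
  | (max_last) \<alpha> \<gamma> where "\<mu> = \<gamma> \<oplus> [1]" "perm132 \<gamma>" "psi_rel \<alpha> ((\<gamma> \<oplus> [1]) \<ominus> \<nu>)" "\<pi> = \<alpha> \<oplus> [1]"
  using assms(1)
proof (cases rule: psi_rel.cases)
  case one
  \<comment> \<open>The singleton is written as a sum with empty parts so that uniqueness
    applies.\<close>
  then have "(\<mu> \<oplus> [1]) \<ominus> \<nu> = ([] \<oplus> [1]) \<ominus> []" by simp
  with that(1) one show ?thesis using max_sum_eq_iff[OF \<mu> \<nu>, of "[]" "[]"] by simp
next
  case (max_first \<alpha> \<alpha>')
  then have "(\<mu> \<oplus> [1]) \<ominus> \<nu> = ([] \<oplus> [1]) \<ominus> \<alpha>'" by simp
  then have "\<mu> = []" "\<nu> = \<alpha>'"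
    using max_sum_eq_iff[OF \<mu> \<nu>, of "[]" \<alpha>'] psi_rel_perm132[OF max_first(3)] by simp_all
  with that(2) max_first show ?thesis using psi_rel_perm132[OF max_first(3)] by simp
next
  case (max_middle \<alpha> \<alpha>' \<beta> \<gamma> \<delta>)
  then have "\<mu> = \<alpha>' \<ominus> (\<delta> \<oplus> [1])" "\<nu> = \<gamma>"
    using max_sum_eq_iff[OF \<mu> \<nu>] psi_rel_perm132[OF max_middle(3)] by simp_all
  with that(3) max_middle show ?thesis using psi_rel_perm132[OF max_middle(3)] by simp
next
  case (max_last \<alpha> \<gamma> \<delta>)
  then have "\<mu> = \<gamma> \<oplus> [1]" "\<nu> = \<delta>"
    using max_sum_eq_iff[OF \<mu> \<nu>] by simp_all
  with that(4) max_last show ?thesis by simp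
qed

text \<open>Induction on one derivation and inversion of the other; \<open>\<pi>'\<close> is
  arbitrary because the induction hypotheses are applied to the parts of the second
  preimage.\<close>

lemma psi_rel_inj: "psi_rel \<pi> \<sigma> \<Longrightarrow> psi_rel \<pi>' \<sigma> \<Longrightarrow> \<pi>' = \<pi>"
proof (induction arbitrary: \<pi>' rule: psi_rel.induct)
  case one
  then have "psi_rel \<pi>' (([] \<oplus> [1]) \<ominus> [])" by simp
  from this perm132_Nil perm132_Nil show ?case
    by (cases rule: psi_rel_cases_max_sum) simp_all
next
  case (max_first \<alpha> \<alpha>')
  note p = psi_rel_perm132[OF max_first.hyps]
  have "psi_rel \<pi>' (([] \<oplus> [1]) \<ominus> \<alpha>')" using max_first.prems by simp
  moreover have "perm132 []" "perm132 \<alpha>'" using p by simp_all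
  ultimately show ?case
    by (cases rule: psi_rel_cases_max_sum) (use p max_first.IH in simp_all)
next
  case (max_middle \<alpha> \<alpha>' \<beta> \<gamma> \<delta>)
  note p = psi_rel_perm132[OF max_middle.hyps(1)]
  then have "perm132 (\<alpha>' \<ominus> (\<delta> \<oplus> [1]))" using max_middle.hyps by simp
  from max_middle.prems this \<open>perm132 \<gamma>\<close> show ?case
  proof (cases rule: psi_rel_cases_max_sum)
    case (max_middle \<alpha>1 \<alpha>1' \<beta>1 \<delta>1)
    \<comment> \<open>Uniqueness of the decomposition at the last entry recovers
      \<open>\<alpha>'\<close> and \<open>\<delta>\<close>; with the common \<open>\<gamma>\<close>,
      both recursive values agree.\<close>
    then have "\<alpha>1' = \<alpha>'" "\<delta>1 = \<delta>"
      using last_sum_eq_iff[of \<alpha>' \<delta> \<alpha>1' \<delta>1] p max_middle.hyps by simp_all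
    with max_middle show ?thesis using max_middle.IH by blast
  next
    case (max_last \<alpha>1 \<gamma>1)
    \<comment> \<open>Ending in the maximum means that the first block at the last entry is empty,
      whereas \<open>\<alpha>'\<close> is a value of the relation and so nonempty.\<close>
    then have "\<alpha>' \<ominus> (\<delta> \<oplus> [1]) = [] \<ominus> (\<gamma>1 \<oplus> [1])" by simp
    then have "\<alpha>' = []"
      using last_sum_eq_iff[of \<alpha>' \<delta> "[]" \<gamma>1] p max_middle.hyps max_last by simp
    then show ?thesis using p by blast
  qed simp_all
next
  case (max_last \<alpha> \<gamma> \<delta>)
  have "perm132 (\<gamma> \<oplus> [1])" using max_last.hyps by simp
  from max_last.prems this \<open>perm132 \<delta>\<close> show ?case
  proof (cases rule: psi_rel_cases_max_sum)
    case (max_middle \<alpha>1 \<alpha>1' \<beta>1 \<delta>1)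
    then have "[] \<ominus> (\<gamma> \<oplus> [1]) = \<alpha>1' \<ominus> (\<delta>1 \<oplus> [1])" by simp
    then have "\<alpha>1' = []"
      using last_sum_eq_iff[of "[]" \<gamma> \<alpha>1' \<delta>1] max_last.hyps max_middle by simp
    then show ?thesis using max_middle by blast
  next
    case (max_last \<alpha>1 \<gamma>1)
    then have "\<gamma>1 \<oplus> [1] = \<gamma> \<oplus> [1]" by simp
    then show ?thesis using max_last max_last.IH by simp
  qed simp_all
qed

theorem theorem2:
  fixes n :: nat
  assumes "n \<ge> 1"
  shows "bij_betw psi (Av132 n) (Av132 n) \<and>
    (\<forall>\<pi>\<in>Av132 n. (stat_B (psi \<pi>), des (psi \<pi>)) = (stat_A \<pi>, des \<pi>))"
proof -
  have rel: "psi_rel \<pi> (psi \<pi>)" if "\<pi> \<in> Av132 n" for \<pi>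
    using psi_rel_psi[of \<pi>] that assms by (fastforce simp: Av132_eq)
  have fin: "finite (Av132 n)"
    by (simp add: Av132_def)
  have inj: "inj_on psi (Av132 n)"
    using rel psi_rel_inj by (metis inj_onI)
  have "psi ` Av132 n \<subseteq> Av132 n"
    using psi_rel_perm132[OF rel] by (fastforce simp: Av132_eq)
  then have "bij_betw psi (Av132 n) (Av132 n)"
    \<comment> \<open>An injective self-map of a finite set is surjective, so no inverse map has to
      be constructed.\<close>
    using endo_inj_surj[OF fin _ inj] inj by (simp add: bij_betw_def)
  then show ?thesis
    using psi_rel_des[OF rel] psi_rel_stat[OF rel] by simp
qed

end
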